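(* For $n\ge 1$ let $\mathcal{U}_n$ be the family of languages accepted with empty stacks by uniform distributed pushdown automata systems (UDPAS) with $n$ components. The families $\mathcal{U}_n$ do not form a hierarchy with respect to the number $n$ of components; that is, it is not the case that $\mathcal{U}_n\subseteq\mathcal{U}_{n+1}$ for all $n\ge 1$.
   Context: A distributed pushdown automata system (DPAS) of degree $n$ consists of $n$ nondeterministic pushdown automata (components) $A_1,\ldots,A_n$ over a common input alphabet, which work in turn on a single common input string read by one common one-way input head. Each component has its own finite control and its own pushdown store; the components may use $\varepsilon$-moves, and a component with empty pushdown store has no move. Initially every component is in its initial state with only its bottom symbol on its pushdown store, and one (arbitrary) component is active. At each point in time exactly one component is active, and only the active component performs transitions, according to its state, the next unread symbol of the common input (or $\varepsilon$) and the topmost symbol of its pushdown store; the states and pushdown stores of the inactive components do not change. The active component stays active as long as it can perform some move; when it has no possible move (it blocks), another, nondeterministically chosen, component becomes active and resumes its computation from its current state and pushdown content. The system is uniform (a UDPAS) if all its components are identical pushdown automata. An input word is accepted with empty stacks if some computation reads the entire input and reaches a situation in which the pushdown stores of all components are empty. *)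

theory Defs
  imports Main
begin

record ('q, 'a, 'g) pda =
  states :: "'q set"
  stack_syms :: "'g set"
  trans :: "'q \<Rightarrow> 'a option \<Rightarrow> 'g \<Rightarrow> ('q \<times> 'g list) set"
  init_state :: 'q
  bottom :: 'g

text \<open>In \<open>trans\<close>, \<open>None\<close> stands for an \<open>\<epsilon>\<close>-move and \<open>Some a\<close> for reading \<open>a\<close>.
  Its values outside the declared states, stack symbols and input alphabet are left
  unconstrained: the configurations reachable on words over the alphabet never use them.\<close>

definition wf_pda :: "'a set \<Rightarrow> ('q, 'a, 'g) pda \<Rightarrow> bool" where
  "wf_pda V A \<longleftrightarrow>
     finite (states A) \<and> finite (stack_syms A) \<and>
     init_state A \<in> states A \<and> bottom A \<in> stack_syms A \<and>
     (\<forall>q \<in> states A. \<forall>x \<in> insert None (Some ` V). \<forall>Z \<in> stack_syms A.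
        finite (trans A q x Z) \<and> trans A q x Z \<subseteq> states A \<times> lists (stack_syms A))"

text \<open>Configurations of a single automaton are triples (unread input, state, pushdown),
  where the pushdown has its top at the head of the list.\<close>

inductive pda_step ::
  "('q, 'a, 'g) pda \<Rightarrow> 'a list \<times> 'q \<times> 'g list \<Rightarrow> 'a list \<times> 'q \<times> 'g list \<Rightarrow> bool"
  for A where
  read: "(q', \<beta>) \<in> trans A q (Some a) Z \<Longrightarrow> pda_step A (a # w, q, Z # \<gamma>) (w, q', \<beta> @ \<gamma>)"
| eps: "(q', \<beta>) \<in> trans A q None Z \<Longrightarrow> pda_step A (w, q, Z # \<gamma>) (w, q', \<beta> @ \<gamma>)"

definition blocked :: "('q, 'a, 'g) pda \<Rightarrow> 'a list \<times> 'q \<times> 'g list \<Rightarrow> bool" where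
  "blocked A c \<longleftrightarrow> \<not> (\<exists>d. pda_step A c d)"

record ('q, 'a, 'g) dpas =
  alphabet :: "'a set"
  components :: "('q, 'a, 'g) pda list"

definition degree :: "('q, 'a, 'g) dpas \<Rightarrow> nat" where
  "degree S = length (components S)"

definition wf_dpas :: "('q, 'a, 'g) dpas \<Rightarrow> bool" where
  "wf_dpas S \<longleftrightarrow> finite (alphabet S) \<and> (\<forall>A \<in> set (components S). wf_pda (alphabet S) A)"

definition uniform :: "('q, 'a, 'g) dpas \<Rightarrow> bool" where
  "uniform S \<longleftrightarrow> (\<forall>A \<in> set (components S). \<forall>B \<in> set (components S). A = B)"

text \<open>Configurations of a system are triples (index of the active component, unread common
  input, list of the local states and pushdowns of the components).\<close>

inductive dpas_step ::
  "('q, 'a, 'g) dpas \<Rightarrow> nat \<times> 'a list \<times> ('q \<times> 'g list) list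
     \<Rightarrow> nat \<times> 'a list \<times> ('q \<times> 'g list) list \<Rightarrow> bool"
  for S where
  move: "\<lbrakk>i < degree S; pda_step (components S ! i) (w, cs ! i) (w', c')\<rbrakk>
     \<Longrightarrow> dpas_step S (i, w, cs) (i, w', cs[i := c'])"
| switch: "\<lbrakk>i < degree S; j < degree S; j \<noteq> i; blocked (components S ! i) (w, cs ! i)\<rbrakk>
     \<Longrightarrow> dpas_step S (i, w, cs) (j, w, cs)"

definition init_locals :: "('q, 'a, 'g) dpas \<Rightarrow> ('q \<times> 'g list) list" where
  "init_locals S = map (\<lambda>A. (init_state A, [bottom A])) (components S)"

definition empty_stack_lang :: "('q, 'a, 'g) dpas \<Rightarrow> 'a list set" where
  "empty_stack_lang S =
     {w \<in> lists (alphabet S). \<exists>i < degree S. \<exists>j cs.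
        (dpas_step S)\<^sup>*\<^sup>* (i, w, init_locals S) (j, [], cs) \<and> (\<forall>c \<in> set cs. snd c = [])}"

text \<open>The alphabets, state sets and stack alphabets are arbitrary finite sets; as these all
  embed into the natural numbers, \<open>nat\<close> serves as the common universe of names.\<close>

definition udpas_family :: "nat \<Rightarrow> nat list set set" where
  "udpas_family n =
     {empty_stack_lang S | S :: (nat, nat, nat) dpas. wf_dpas S \<and> uniform S \<and> degree S = n}"

end

theory Submission
  imports Defs
begin

text \<open>A component of a system that accepts \<open>w\<close> either reads a symbol of \<open>w\<close> or empties its
  pushdown by \<open>\<epsilon>\<close>-moves alone. If \<open>w\<close> is shorter than the degree, some component does the
  latter, and in a uniform system all the other components can imitate it, so that the empty
  word is accepted as well. Hence \<open>{a}\<close>, which a single pushdown automaton accepts, is not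
  accepted by any UDPAS of degree at least two.\<close>

text \<open>With no input left, \<open>read\<close> cannot apply, so fixing the input to
  \<open>[]\<close> leaves exactly the \<epsilon>-moves.\<close>

abbreviation eps_step ::
  "('q, 'a, 'g) pda \<Rightarrow> 'q \<times> 'g list \<Rightarrow> 'q \<times> 'g list \<Rightarrow> bool" where
  "eps_step A c d \<equiv> pda_step A ([], c) ([], d)"

lemma pda_step_cases_input:
  assumes "pda_step A (w, c) (w', d)"
  obtains "length w = Suc (length w')" | "w' = w" "eps_step A c d"
  using assms by (cases rule: pda_step.cases) (auto intro: pda_step.eps)

lemma not_pda_step_empty_stack: "\<not> pda_step A (w, q, []) c"
  by (auto elim: pda_step.cases)

lemma uniform_components:
  assumes "uniform S"
  obtains A where "components S = replicate (degree S) A"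
proof (cases "components S")
  case Nil
  then show ?thesis by (auto simp: degree_def intro: that)
next
  case (Cons A As)
  then have "\<forall>B \<in> set (components S). B = A"
    using assms by (auto simp: uniform_def)
  then show ?thesis
    by (metis degree_def replicate_length_same that)
qed

text \<open>Invariant of a run: only a reading move can make a component lose
  \<open>eps_reached\<close>; such a move affects the active component alone and consumes one
  letter. The converse may fail, since a component that has read can still be in a configuration
  reachable by \<epsilon>-moves; hence an inequality.\<close>

lemma reading_components_le_length:
  assumes "(dpas_step S)\<^sup>*\<^sup>* (i, w, init_locals S) (j, v, cs)"
  defines "eps_reached \<equiv> \<lambda>cs k.
    (eps_step (components S ! k))\<^sup>*\<^sup>* (init_locals S ! k) (cs ! k)"
  shows "length cs = degree S \<and>
    card {k. k < degree S \<and> \<not> eps_reached cs k} + length v \<le> length w"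
  using assms(1)
proof (induction "(j, v, cs)" arbitrary: j v cs rule: rtranclp_induct)
  case base
  then show ?case by (simp add: eps_reached_def init_locals_def degree_def)
next
  case (step y)
  obtain j0 v0 cs0 where y: "y = (j0, v0, cs0)" by (cases y)
  let ?R = "\<lambda>cs. {k. k < degree S \<and> \<not> eps_reached cs k}"
  have IH: "length cs0 = degree S" "card (?R cs0) + length v0 \<le> length w"
    using step.hyps(3)[OF y] by auto
  from step.hyps(2)[unfolded y] show ?case
  proof (cases rule: dpas_step.cases)
    case (move c')
    from move(4) show ?thesis
    proof (cases rule: pda_step_cases_input)
      case 1
      have "?R cs \<subseteq> insert j0 (?R cs0)"
        using move by (auto simp: eps_reached_def nth_list_update)
      then have "card (?R cs) \<le> card (insert j0 (?R cs0))"
        by (intro card_mono) auto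
      also have "\<dots> \<le> Suc (card (?R cs0))"
        by (simp add: card_insert_if)
      finally show ?thesis using IH 1 move by simp
    next
      case 2
      \<comment> \<open>An \<epsilon>-move prolongs the \<epsilon>-run of \<open>j0\<close> by one
        step and leaves the other components unchanged.\<close>
      have "eps_reached cs k" if "eps_reached cs0 k" for k
      proof (cases "k = j0")
        case True
        then show ?thesis
          using that 2 move IH unfolding eps_reached_def
          by (auto intro: rtranclp.rtrancl_into_rtrancl)
      next
        case False
        then show ?thesis using that move by (simp add: eps_reached_def)
      qed
      then have "card (?R cs) \<le> card (?R cs0)"
        by (intro card_mono) auto
      then show ?thesis using IH 2 move by simp
    qed
  next
    case switch
    then show ?thesis using IH by simp
  qed
qed

lemma dpas_steps_eps:
  assumes "(eps_step (components S ! i))\<^sup>*\<^sup>* c d" "i < degree S" "i < length cs" "cs ! i = c"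
  shows "(dpas_step S)\<^sup>*\<^sup>* (i, [], cs) (i, [], cs[i := d])"
  using assms(1)
proof (induction rule: rtranclp_induct)
  case base
  then show ?case using assms(4) by auto
next
  case (step d e)
  have "dpas_step S (i, [], cs[i := d]) (i, [], (cs[i := d])[i := e])"
    using step.hyps(2) assms by (intro dpas_step.move) auto
  then show ?case using step.IH by simp
qed

text \<open>The components perform the given \<epsilon>-run one after another; each is blocked once
  its pushdown is empty, which permits the switch to the next.\<close>

lemma Nil_accepted_if_eps_emptying:
  assumes comps: "components S = replicate (Suc n) A"
    and run: "(eps_step A)\<^sup>*\<^sup>* (init_state A, [bottom A]) (q, [])"
  shows "[] \<in> empty_stack_lang S"
proof -
  let ?c = "(init_state A, [bottom A])" and ?d = "(q, [])"
  \<comment> \<open>The first \<open>m\<close> components have been emptied, the others are still in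
    their initial configuration.\<close>
  let ?cs = "\<lambda>m. replicate m ?d @ replicate (Suc n - m) ?c"
  have deg: "degree S = Suc n" using comps by (simp add: degree_def)
  have init: "init_locals S = ?cs 0" using comps by (simp add: init_locals_def)
  have empty: "(dpas_step S)\<^sup>*\<^sup>* (m, [], ?cs m) (m, [], ?cs (Suc m))" if "m \<le> n" for m
  proof -
    have "(?cs m)[m := ?d] = ?cs (Suc m)"
      using that by (intro nth_equalityI) (auto simp: nth_append nth_list_update simp del: replicate_Suc)
    moreover have "components S ! m = A"
      using that by (simp only: comps nth_replicate)
    then have "(dpas_step S)\<^sup>*\<^sup>* (m, [], ?cs m) (m, [], (?cs m)[m := ?d])"
      using that run deg by (intro dpas_steps_eps[where c = ?c]) (auto simp: nth_append)
    ultimately show ?thesis by simp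
  qed
  have "(dpas_step S)\<^sup>*\<^sup>* (0, [], ?cs 0) (m, [], ?cs (Suc m))" if "m \<le> n" for m
    using that
  proof (induction m)
    case 0
    then show ?case using empty[of 0] by blast
  next
    case (Suc m)
    have "dpas_step S (m, [], ?cs (Suc m)) (Suc m, [], ?cs (Suc m))"
      using Suc.prems deg
      by (intro dpas_step.switch)
        (auto simp: blocked_def nth_append not_pda_step_empty_stack simp del: replicate_Suc)
    with Suc empty[of "Suc m"] show ?case
      by (meson Suc_leD rtranclp.rtrancl_into_rtrancl rtranclp_trans)
  qed
  from this[of n] have "(dpas_step S)\<^sup>*\<^sup>* (0, [], init_locals S) (n, [], ?cs (Suc n))"
    using init by simp
  moreover have "\<forall>c \<in> set (?cs (Suc n)). snd c = []" by auto
  ultimately show ?thesis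
    unfolding empty_stack_lang_def using deg
    by (intro CollectI conjI exI[of _ 0] exI[of _ n] exI[of _ "?cs (Suc n)"]) auto
qed

lemma Nil_accepted_if_short_word_accepted:
  assumes "uniform S" "w \<in> empty_stack_lang S" "length w < degree S"
  shows "[] \<in> empty_stack_lang S"
proof -
  obtain A where comps: "components S = replicate (degree S) A"
    using uniform_components[OF assms(1)] .
  obtain i j cs where
    run: "(dpas_step S)\<^sup>*\<^sup>* (i, w, init_locals S) (j, [], cs)" and
    empty: "\<forall>c \<in> set cs. snd c = []"
    using assms(2) unfolding empty_stack_lang_def by blast
  let ?eps_reached = "\<lambda>k. (eps_step (components S ! k))\<^sup>*\<^sup>* (init_locals S ! k) (cs ! k)"
  have len: "length cs = degree S" and
    "card {k. k < degree S \<and> \<not> ?eps_reached k} < degree S"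
    using reading_components_le_length[OF run] assms(3) by auto
  \<comment> \<open>Pigeonhole: there are too few exceptional indices to exhaust all
    components.\<close>
  then have "{k. k < degree S \<and> \<not> ?eps_reached k} \<noteq> {..<degree S}"
    by (metis card_lessThan less_irrefl)
  then obtain k where k: "k < degree S" "?eps_reached k" by auto
  have "components S ! k = A" using k(1) comps by (metis nth_replicate)
  moreover from this have "init_locals S ! k = (init_state A, [bottom A])"
    using k(1) by (simp add: init_locals_def degree_def)
  moreover have "snd (cs ! k) = []" using k(1) len empty by simp
  ultimately have "(eps_step A)\<^sup>*\<^sup>* (init_state A, [bottom A]) (fst (cs ! k), [])"
    using k(2) by (metis prod.collapse)
  moreover obtain n where "degree S = Suc n" using k(1) by (cases "degree S") auto
  ultimately show ?thesis
    using Nil_accepted_if_eps_emptying comps by metis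
qed

text \<open>Its only move pops the bottom symbol while reading the letter; \<open>0\<close> names
  the state, the letter and the stack symbol alike.\<close>

definition letter_pda :: "(nat, nat, nat) pda" where
  "letter_pda = \<lparr>states = {0}, stack_syms = {0},
     trans = (\<lambda>q x Z. if q = 0 \<and> x = Some 0 \<and> Z = 0 then {(0, [])} else {}),
     init_state = 0, bottom = 0\<rparr>"

definition letter_system :: "(nat, nat, nat) dpas" where
  "letter_system = \<lparr>alphabet = {0}, components = [letter_pda]\<rparr>"

lemma letter_pda_step_iff:
  "pda_step letter_pda c d \<longleftrightarrow> (\<exists>w \<gamma>. c = (0 # w, 0, 0 # \<gamma>) \<and> d = (w, 0, \<gamma>))"
proof
  assume "pda_step letter_pda c d"
  then show "\<exists>w \<gamma>. c = (0 # w, 0, 0 # \<gamma>) \<and> d = (w, 0, \<gamma>)"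
    by cases (auto simp: letter_pda_def split: if_splits)
next
  assume "\<exists>w \<gamma>. c = (0 # w, 0, 0 # \<gamma>) \<and> d = (w, 0, \<gamma>)"
  then show "pda_step letter_pda c d"
    using pda_step.read[of 0 "[]" letter_pda 0 0 0] by (auto simp: letter_pda_def)
qed

lemma init_locals_letter_system: "init_locals letter_system = [(0, [0])]"
  by (simp add: init_locals_def letter_system_def letter_pda_def)

lemma degree_letter_system: "degree letter_system = 1"
  by (simp add: degree_def letter_system_def)

lemma components_letter_system: "components letter_system = [letter_pda]"
  by (simp add: letter_system_def)

text \<open>With one component there is nothing to switch to, and after the single pop no move
  remains.\<close>

lemma letter_system_steps:
  assumes "(dpas_step letter_system)\<^sup>*\<^sup>* (i, w, [(0, [0])]) c"
  shows "c = (i, w, [(0, [0])]) \<or> (\<exists>w'. w = 0 # w' \<and> c = (i, w', [(0, [])]))"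
  using assms
proof (induction rule: rtranclp_induct)
  case base
  then show ?case by simp
next
  case (step c d)
  from step.hyps(2) step.IH show ?case
    by cases (auto simp: degree_letter_system components_letter_system letter_pda_step_iff)
qed

lemma lang_letter_system: "empty_stack_lang letter_system = {[0]}"
proof -
  \<comment> \<open>Acceptance needs an empty pushdown, so the pop has occurred, and the rest
    \<open>w'\<close> of the input must be \<open>[]\<close>.\<close>
  have "w = [0]" if "w \<in> empty_stack_lang letter_system" for w
    using that letter_system_steps
    by (fastforce simp: empty_stack_lang_def init_locals_letter_system)
  moreover have "dpas_step letter_system (0, [0], [(0, [0])]) (0, [], [(0, [0])][0 := (0, [])])"
    by (intro dpas_step.move)
      (auto simp: degree_letter_system components_letter_system letter_pda_step_iff)
  then have "(dpas_step letter_system)\<^sup>*\<^sup>* (0, [0], init_locals letter_system) (0, [], [(0, [])])"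
    by (simp add: init_locals_letter_system r_into_rtranclp)
  then have "[0] \<in> empty_stack_lang letter_system"
    unfolding empty_stack_lang_def
    using degree_letter_system by (force simp: letter_system_def)
  ultimately show ?thesis by blast
qed

lemma letter_in_udpas_family_1: "{[0]} \<in> udpas_family 1"
proof -
  have "wf_dpas letter_system" "uniform letter_system"
    by (auto simp: wf_dpas_def wf_pda_def uniform_def letter_system_def letter_pda_def)
  then show ?thesis
    using lang_letter_system degree_letter_system unfolding udpas_family_def by blast
qed

text \<open>From two components on, \<open>[0]\<close> is shorter than the degree, so accepting it
  would force acceptance of \<open>[]\<close>.\<close>

lemma letter_notin_udpas_family:
  assumes "n \<ge> 2"
  shows "{[0]} \<notin> udpas_family n"
proof
  assume "{[0]} \<in> udpas_family n"
  then obtain S :: "(nat, nat, nat) dpas" where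
    "uniform S" "degree S = n" "empty_stack_lang S = {[0]}"
    unfolding udpas_family_def by auto
  then show False
    using Nil_accepted_if_short_word_accepted[of S "[0]"] assms by simp
qed

theorem theorem2: "\<not> (\<forall>n\<ge>1. udpas_family n \<subseteq> udpas_family (n + 1))"
  \<comment> \<open>The inclusion already fails at \<open>n = 1\<close>; \<open>1 + 1\<close>
    matches the form of \<open>n + 1\<close> there.\<close>
  using letter_in_udpas_family_1 letter_notin_udpas_family[of "1 + 1"] by fastforce

end
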